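(* The problems MCFOD and $r$MCFOD defined in the context result in the same optimal solution: they have the same optimal value, and there is a tuple $(R^*,a,p,q)$ that is simultaneously an optimal solution of MCFOD and of $r$MCFOD.
   Context: Data. $V$ is a finite node set, $\emptyset\ne H\subset V$ the set of hubs, $K$ a finite nonempty set of carriers (with $0\notin K$), $R$ a finite set of commodities. Each $r\in R$ has an origin $o(r)\in V$, a destination $d(r)\in V$, not both in $H$, and a revenue $b^r>0$. For $r\in R$ and $i,j\in H$ (possibly $i=j$), $c^r_{ij}>0$ is the leader's interhub routing cost (for each $r$ it satisfies the triangle inequality). For $k\in K$, $i\in H$: $\overline c^{\,rk}_{o(r)i}>0$ (if $o(r)\notin H$) and $\overline c^{\,rk}_{id(r)}>0$ (if $d(r)\notin H$) are the reservation prices of carrier $k$ for the first leg of $r$ (from $o(r)$ to hub $i$) and the third leg of $r$ (from hub $i$ to $d(r)$). Leader's decisions. A subset $R^*\subseteq R$ of served commodities; an allocation $a:V\setminus H\to K\cup\{0\}$ ($a(i)=0$ means $i$ is not allocated); outsourcing fees $p^r_i\ge0$ for $i\in H$, $o(r)\notin H$, and $q^r_i\ge0$ for $i\in H$, $d(r)\notin H$. Profit-maximizing carriers. $I_k(r,p)=\arg\max_{i\in H}\{p^r_i-\overline c^{\,rk}_{o(r)i}\}$ if this maximum is $\ge0$ and $I_k(r,p)=\emptyset$ otherwise; $J_k(r,q)=\arg\max_{i\in H}\{q^r_i-\overline c^{\,rk}_{id(r)}\}$ if this maximum is $\ge0$ and $J_k(r,q)=\emptyset$ otherwise. Reservation-price-oriented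 carriers. $rI_k(r,p)=\{i\in H:p^r_i-\overline c^{\,rk}_{o(r)i}\ge0\}$, $rJ_k(r,q)=\{i\in H:q^r_i-\overline c^{\,rk}_{id(r)}\ge0\}$. For $k=0$ all these sets are empty. Routing cost. $C_r(a,p,q)$ equals $\min\{p^r_i+c^r_{ij}+q^r_j:i\in I_{a(o(r))}(r,p),\,j\in J_{a(d(r))}(r,q)\}$ if $o(r),d(r)\notin H$; $\min\{p^r_i+c^r_{id(r)}:i\in I_{a(o(r))}(r,p)\}$ if $o(r)\notin H$, $d(r)\in H$; $\min\{c^r_{o(r)j}+q^r_j:j\in J_{a(d(r))}(r,q)\}$ if $o(r)\in H$, $d(r)\notin H$; where the minimum over an empty set is $+\infty$. $rC_r(a,p,q)$ is defined in the same way with $rI,rJ$ in place of $I,J$. MCFOD: maximize $\sum_{r\in R^*}[b^r-C_r(a,p,q)]$ over $(R^*,a,p,q)$. $r$MCFOD: maximize $\sum_{r\in R^*}[b^r-rC_r(a,p,q)]$ over $(R^*,a,p,q)$. *)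

theory Defs
  imports Complex_Main "HOL-Library.Extended_Real"
begin

record ('v, 'k, 'r) fod_data =
  nodes :: "'v set"
  hubs :: "'v set"
  carriers :: "'k set"
  commodities :: "'r set"
  orig :: "'r \<Rightarrow> 'v"
  dest :: "'r \<Rightarrow> 'v"
  revenue :: "'r \<Rightarrow> real"
  hub_cost :: "'r \<Rightarrow> 'v \<Rightarrow> 'v \<Rightarrow> real"
  res_price :: "'r \<Rightarrow> 'k \<Rightarrow> 'v \<Rightarrow> 'v \<Rightarrow> real"

text \<open>
  \<^term>\<open>res_price D r k u v\<close> is the reservation price of carrier k for moving commodity r from
  u to v; only the pairs (origin, hub) with non-hub origin and (hub, destination) with non-hub
  destination matter.
\<close>

definition valid_data :: "('v, 'k, 'r) fod_data \<Rightarrow> bool" where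
  "valid_data D \<longleftrightarrow>
     finite (nodes D) \<and> hubs D \<noteq> {} \<and> hubs D \<subset> nodes D \<and>
     finite (carriers D) \<and> carriers D \<noteq> {} \<and>
     finite (commodities D) \<and>
     (\<forall>r\<in>commodities D.
        orig D r \<in> nodes D \<and> dest D r \<in> nodes D \<and>
        \<not> (orig D r \<in> hubs D \<and> dest D r \<in> hubs D) \<and>
        revenue D r > 0 \<and>
        (\<forall>i\<in>hubs D. \<forall>j\<in>hubs D. hub_cost D r i j > 0) \<and>
        (\<forall>i\<in>hubs D. \<forall>j\<in>hubs D. \<forall>l\<in>hubs D.
           hub_cost D r i j \<le> hub_cost D r i l + hub_cost D r l j) \<and>
        (\<forall>k\<in>carriers D. \<forall>i\<in>hubs D.
           (orig D r \<notin> hubs D \<longrightarrow> res_price D r k (orig D r) i > 0) \<and>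
           (dest D r \<notin> hubs D \<longrightarrow> res_price D r k i (dest D r) > 0)))"

text \<open>
  A decision is a tuple (served commodities, allocation, first-leg fees, third-leg fees).
  The dummy carrier 0 is rendered as \<^term>\<open>None\<close>.  Values of the allocation and of the fees
  outside their mathematical domains are unconstrained; the objective does not depend on them.
\<close>

type_synonym ('v, 'k, 'r) decision =
  "'r set \<times> ('v \<Rightarrow> 'k option) \<times> ('r \<Rightarrow> 'v \<Rightarrow> real) \<times> ('r \<Rightarrow> 'v \<Rightarrow> real)"

definition feasible :: "('v, 'k, 'r) fod_data \<Rightarrow> ('v, 'k, 'r) decision \<Rightarrow> bool" where
  "feasible D = (\<lambda>(S, a, p, q).
     S \<subseteq> commodities D \<and>
     (\<forall>i \<in> nodes D - hubs D. a i \<in> insert None (Some ` carriers D)) \<and>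
     (\<forall>r\<in>commodities D. \<forall>i\<in>hubs D.
        (orig D r \<notin> hubs D \<longrightarrow> p r i \<ge> 0) \<and> (dest D r \<notin> hubs D \<longrightarrow> q r i \<ge> 0)))"

text \<open>
  The two carrier behaviours, as rules that select hubs from the set A given the profit f i
  earned at hub i.
\<close>

definition profit_maximizing :: "'v set \<Rightarrow> ('v \<Rightarrow> real) \<Rightarrow> 'v set" where
  "profit_maximizing A f =
     (if Max (f ` A) \<ge> 0 then {i. is_arg_max f (\<lambda>i. i \<in> A) i} else {})"

definition reservation_oriented :: "'v set \<Rightarrow> ('v \<Rightarrow> real) \<Rightarrow> 'v set" where
  "reservation_oriented A f = {i \<in> A. f i \<ge> 0}"

definition first_leg_hubs ::
  "('v set \<Rightarrow> ('v \<Rightarrow> real) \<Rightarrow> 'v set) \<Rightarrow> ('v, 'k, 'r) fod_data \<Rightarrow>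
   'k option \<Rightarrow> 'r \<Rightarrow> ('r \<Rightarrow> 'v \<Rightarrow> real) \<Rightarrow> 'v set" where
  "first_leg_hubs rule D x r p =
     (case x of None \<Rightarrow> {}
      | Some k \<Rightarrow> rule (hubs D) (\<lambda>i. p r i - res_price D r k (orig D r) i))"

definition third_leg_hubs ::
  "('v set \<Rightarrow> ('v \<Rightarrow> real) \<Rightarrow> 'v set) \<Rightarrow> ('v, 'k, 'r) fod_data \<Rightarrow>
   'k option \<Rightarrow> 'r \<Rightarrow> ('r \<Rightarrow> 'v \<Rightarrow> real) \<Rightarrow> 'v set" where
  "third_leg_hubs rule D x r q =
     (case x of None \<Rightarrow> {}
      | Some k \<Rightarrow> rule (hubs D) (\<lambda>i. q r i - res_price D r k i (dest D r)))"

definition min_or_infinity :: "real set \<Rightarrow> ereal" where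
  "min_or_infinity X = (if X = {} then \<infinity> else ereal (Min X))"

text \<open>
  The last branch is the case of a hub origin and a non-hub destination, since valid data
  exclude commodities with both endpoints in the hub set.
\<close>

definition routing_cost ::
  "('v set \<Rightarrow> ('v \<Rightarrow> real) \<Rightarrow> 'v set) \<Rightarrow> ('v, 'k, 'r) fod_data \<Rightarrow> 'r \<Rightarrow>
   ('v \<Rightarrow> 'k option) \<Rightarrow> ('r \<Rightarrow> 'v \<Rightarrow> real) \<Rightarrow> ('r \<Rightarrow> 'v \<Rightarrow> real) \<Rightarrow> ereal" where
  "routing_cost rule D r a p q =
     (let I = first_leg_hubs rule D (a (orig D r)) r p;
          J = third_leg_hubs rule D (a (dest D r)) r q
      in if orig D r \<notin> hubs D \<and> dest D r \<notin> hubs D then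
           min_or_infinity {p r i + hub_cost D r i j + q r j | i j. i \<in> I \<and> j \<in> J}
         else if orig D r \<notin> hubs D then
           min_or_infinity {p r i + hub_cost D r i (dest D r) | i. i \<in> I}
         else
           min_or_infinity {hub_cost D r (orig D r) j + q r j | j. j \<in> J})"

definition total_profit ::
  "('v set \<Rightarrow> ('v \<Rightarrow> real) \<Rightarrow> 'v set) \<Rightarrow> ('v, 'k, 'r) fod_data \<Rightarrow>
   ('v, 'k, 'r) decision \<Rightarrow> ereal" where
  "total_profit rule D =
     (\<lambda>(S, a, p, q). \<Sum>r\<in>S. ereal (revenue D r) - routing_cost rule D r a p q)"

definition MCFOD_objective :: "('v, 'k, 'r) fod_data \<Rightarrow> ('v, 'k, 'r) decision \<Rightarrow> ereal" where
  "MCFOD_objective = total_profit profit_maximizing"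

definition rMCFOD_objective :: "('v, 'k, 'r) fod_data \<Rightarrow> ('v, 'k, 'r) decision \<Rightarrow> ereal" where
  "rMCFOD_objective = total_profit reservation_oriented"

end

theory Submission imports Defs begin

text \<open>
  Fix an allocation. Every hub used by either kind of carrier is paid at least its reservation
  price, so routing a commodity costs at least the cheapest total of reservation prices and
  interhub cost. Paying exactly the reservation price at the hubs of a cheapest route, and nothing
  elsewhere, leaves a single acceptable hub per leg, because reservation prices are positive; hence
  both carrier behaviours attain this bound. It remains to maximize over the finitely many
  allocations.
\<close>

section \<open>Extended minima and the hubs selected by the two behaviours\<close>

lemma min_or_infinity_greatest:
  assumes "finite X" "\<And>x. x \<in> X \<Longrightarrow> m \<le> x"
  shows "ereal m \<le> min_or_infinity X"
  using assms by (simp add: min_or_infinity_def)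

lemma min_or_infinity_antimono:
  assumes "finite Y" "X \<subseteq> Y"
  shows "min_or_infinity Y \<le> min_or_infinity X"
  using assms by (auto simp: min_or_infinity_def intro: Min_antimono)

lemma min_or_infinity_empty [simp]: "min_or_infinity {} = \<infinity>"
  and min_or_infinity_singleton [simp]: "min_or_infinity {x} = ereal x"
  by (simp_all add: min_or_infinity_def)

text \<open>A maximizer attains the maximal profit, and the rule selects hubs only when that maximum
  is nonnegative.\<close>

lemma profit_maximizing_subset:
  assumes "finite A"
  shows "profit_maximizing A f \<subseteq> reservation_oriented A f"
proof
  fix i assume i: "i \<in> profit_maximizing A f"
  then have M: "0 \<le> Max (f ` A)" and arg: "is_arg_max f (\<lambda>i. i \<in> A) i"
    by (auto simp: profit_maximizing_def split: if_splits)
  from arg have iA: "i \<in> A" and best: "\<And>j. j \<in> A \<Longrightarrow> f j \<le> f i"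
    by (auto simp: is_arg_max_linorder)
  have "Max (f ` A) \<le> f i"
    using assms iA best by (subst Max_le_iff) auto
  with M iA show "i \<in> reservation_oriented A f"
    by (simp add: reservation_oriented_def)
qed

text \<open>Here \<open>g\<close> is meant to be a carrier's reservation price as a function of the
  hub. The value 0 is the lowest feasible fee and deters the carrier wherever \<open>g\<close> is
  positive.\<close>

definition single_fee :: "('v \<Rightarrow> real) \<Rightarrow> 'v \<Rightarrow> 'v \<Rightarrow> real" where
  "single_fee g h = (\<lambda>i. if i = h then g h else 0)"

lemma reservation_oriented_single_fee:
  assumes "h \<in> A" "\<And>i. i \<in> A \<Longrightarrow> g i > 0"
  shows "reservation_oriented A (\<lambda>i. single_fee g h i - g i) = {h}"
  using assms by (force simp: reservation_oriented_def single_fee_def)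

text \<open>The profit at \<open>h\<close> is exactly 0, which just meets the acceptance threshold,
  and every other hub in \<open>A\<close> gives a strictly negative profit. Thus the maximum passes
  the threshold and its maximizer is unique.\<close>

lemma profit_maximizing_single_fee:
  assumes "finite A" "h \<in> A" "\<And>i. i \<in> A \<Longrightarrow> g i > 0"
  shows "profit_maximizing A (\<lambda>i. single_fee g h i - g i) = {h}"
proof -
  let ?f = "\<lambda>i. single_fee g h i - g i"
  have "?f h = 0" and neg: "\<And>i. i \<in> A \<Longrightarrow> i \<noteq> h \<Longrightarrow> ?f i < 0"
    using assms by (auto simp: single_fee_def)
  moreover have "?f h \<le> Max (?f ` A)"
    using assms by (intro Max_ge) auto
  moreover have "{i. is_arg_max ?f (\<lambda>i. i \<in> A) i} = {h}"
    using assms(2) \<open>?f h = 0\<close> neg by (force simp: is_arg_max_def)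
  ultimately show ?thesis
    by (simp add: profit_maximizing_def)
qed

section \<open>Legs and routing costs under both behaviours\<close>

lemma legs_subset:
  assumes "finite (hubs D)"
  shows "first_leg_hubs profit_maximizing D x r p \<subseteq> first_leg_hubs reservation_oriented D x r p"
    and "third_leg_hubs profit_maximizing D x r q \<subseteq> third_leg_hubs reservation_oriented D x r q"
  using profit_maximizing_subset[OF assms]
  by (auto simp: first_leg_hubs_def third_leg_hubs_def split: option.splits)

lemma finite_reservation_legs:
  assumes "finite (hubs D)"
  shows "finite (first_leg_hubs reservation_oriented D x r p)"
    and "finite (third_leg_hubs reservation_oriented D x r q)"
  using assms
  by (auto simp: first_leg_hubs_def third_leg_hubs_def reservation_oriented_def split: option.splits)

lemma legs_None [simp]:
  "first_leg_hubs rule D None r p = {}" "third_leg_hubs rule D None r q = {}"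
  by (simp_all add: first_leg_hubs_def third_leg_hubs_def)

lemma reservation_first_legD:
  assumes "i \<in> first_leg_hubs reservation_oriented D (Some k) r p"
  shows "i \<in> hubs D" "res_price D r k (orig D r) i \<le> p r i"
  using assms by (auto simp: first_leg_hubs_def reservation_oriented_def)

lemma reservation_third_legD:
  assumes "j \<in> third_leg_hubs reservation_oriented D (Some k) r q"
  shows "j \<in> hubs D" "res_price D r k j (dest D r) \<le> q r j"
  using assms by (auto simp: third_leg_hubs_def reservation_oriented_def)

text \<open>For the same allocation and fees, reservation-oriented carriers leave at least as many
  routes available, so the minimum is taken over a larger finite set.\<close>

lemma reservation_cost_le_profit_cost:
  assumes "finite (hubs D)"
  shows "routing_cost reservation_oriented D r a p q \<le> routing_cost profit_maximizing D r a p q"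
proof -
  note sub = legs_subset[OF assms, THEN subsetD]
  note fin = finite_reservation_legs[OF assms]
  show ?thesis
    unfolding routing_cost_def Let_def
    by (auto intro!: min_or_infinity_antimono finite_image_set finite_image_set2 intro: sub simp: fin)
qed

text \<open>Collecting both behaviours lets each exact cost computation be stated once for the two
  problems.\<close>

definition carrier_rules :: "('v set \<Rightarrow> ('v \<Rightarrow> real) \<Rightarrow> 'v set) set" where
  "carrier_rules = {profit_maximizing, reservation_oriented}"

lemma first_leg_single_fee:
  assumes "rule \<in> carrier_rules" "finite (hubs D)" "h \<in> hubs D"
    "\<And>i. i \<in> hubs D \<Longrightarrow> res_price D r k (orig D r) i > 0"
    "p r = single_fee (res_price D r k (orig D r)) h"
  shows "first_leg_hubs rule D (Some k) r p = {h}"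
  using assms reservation_oriented_single_fee[of h "hubs D" "res_price D r k (orig D r)"]
    profit_maximizing_single_fee[of "hubs D" h "res_price D r k (orig D r)"]
  by (auto simp: first_leg_hubs_def carrier_rules_def)

lemma third_leg_single_fee:
  assumes "rule \<in> carrier_rules" "finite (hubs D)" "h \<in> hubs D"
    "\<And>i. i \<in> hubs D \<Longrightarrow> res_price D r k i (dest D r) > 0"
    "q r = single_fee (\<lambda>i. res_price D r k i (dest D r)) h"
  shows "third_leg_hubs rule D (Some k) r q = {h}"
  using assms reservation_oriented_single_fee[of h "hubs D" "\<lambda>i. res_price D r k i (dest D r)"]
    profit_maximizing_single_fee[of "hubs D" h "\<lambda>i. res_price D r k i (dest D r)"]
  by (auto simp: third_leg_hubs_def carrier_rules_def)

section \<open>Optimal fees for one commodity under a fixed allocation\<close>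

lemma ex_min_on_finite:
  fixes f :: "'a \<Rightarrow> 'b::linorder"
  assumes "finite A" "A \<noteq> {}"
  obtains x where "x \<in> A" "\<And>y. y \<in> A \<Longrightarrow> f x \<le> f y"
proof -
  have "Min (f ` A) \<in> f ` A"
    using assms by simp
  then obtain x where "x \<in> A" and x: "Min (f ` A) = f x"
    by blast
  moreover have "f x \<le> f y" if "y \<in> A" for y
    using Min_le[of "f ` A" "f y"] that assms(1) by (simp flip: x)
  ultimately show thesis
    using that by blast
qed

lemma ex_max_on_finite:
  fixes f :: "'a \<Rightarrow> 'b::linorder"
  assumes "finite A" "A \<noteq> {}"
  obtains x where "x \<in> A" "\<And>y. y \<in> A \<Longrightarrow> f y \<le> f x"
proof -
  have "Max (f ` A) \<in> f ` A"
    using assms by simp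
  then obtain x where "x \<in> A" and x: "Max (f ` A) = f x"
    by blast
  moreover have "f y \<le> f x" if "y \<in> A" for y
    using Max_ge[of "f ` A" "f y"] that assms(1) by (simp flip: x)
  ultimately show thesis
    using that by blast
qed

definition valid_allocation :: "('v, 'k, 'r) fod_data \<Rightarrow> ('v \<Rightarrow> 'k option) \<Rightarrow> bool" where
  "valid_allocation D a \<longleftrightarrow> (\<forall>i \<in> nodes D - hubs D. a i \<in> insert None (Some ` carriers D))"

text \<open>The equality ranges over all \<open>p\<close>, \<open>q\<close> that agree with
  \<open>P\<close>, \<open>Q\<close> at \<open>r\<close>, so fees found for different commodities
  can later be combined. The lower bound concerns only the reservation-oriented rule, whose cost is
  the smaller one.\<close>

definition optimal_fees ::
  "('v, 'k, 'r) fod_data \<Rightarrow> ('v \<Rightarrow> 'k option) \<Rightarrow> 'r \<Rightarrow> ('v \<Rightarrow> real) \<Rightarrow> ('v \<Rightarrow> real) \<Rightarrow> ereal \<Rightarrow> bool" where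
  "optimal_fees D a r P Q m \<longleftrightarrow>
     (\<forall>i\<in>hubs D. (orig D r \<notin> hubs D \<longrightarrow> P i \<ge> 0) \<and> (dest D r \<notin> hubs D \<longrightarrow> Q i \<ge> 0)) \<and>
     (\<forall>p q. p r = P \<longrightarrow> q r = Q \<longrightarrow> (\<forall>rule\<in>carrier_rules. routing_cost rule D r a p q = m)) \<and>
     (\<forall>p q. m \<le> routing_cost reservation_oriented D r a p q)"

text \<open>The value \<open>m\<close> is the cheapest sum of reservation prices and interhub cost
  over the hubs that may be used, or infinity if a non-hub endpoint has no carrier.\<close>

lemma ex_optimal_fees:
  fixes D :: "('v, 'k, 'r) fod_data"
  assumes D: "valid_data D" and a: "valid_allocation D a" and r: "r \<in> commodities D"
  shows "\<exists>P Q m. optimal_fees D a r P Q m"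
proof -
  define H where "H = hubs D"
  define o' where "o' = orig D r"
  define d where "d = dest D r"
  note defs = H_def o'_def d_def
  define c where "c = hub_cost D r"
  have fH: "finite H" and H: "H \<noteq> {}"
    using D by (auto simp: valid_data_def H_def intro: finite_subset)
  have od: "o' \<in> nodes D" "d \<in> nodes D" "\<not> (o' \<in> H \<and> d \<in> H)"
    using D r by (auto simp: valid_data_def defs)
  have pos: "o' \<notin> H \<Longrightarrow> res_price D r k o' i > 0" "d \<notin> H \<Longrightarrow> res_price D r k i d > 0"
    if "k \<in> carriers D" "i \<in> H" for k i
    using D r that by (auto simp: valid_data_def defs)
  have alloc: "a v = None \<or> (\<exists>k\<in>carriers D. a v = Some k)" if "v \<in> nodes D" "v \<notin> H" for v
    using a that by (auto simp: valid_allocation_def H_def)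
  note fin = finite_reservation_legs[OF fH[unfolded H_def]]
  note leg1 = first_leg_single_fee[where r = r, OF _ fH[unfolded H_def], folded defs]
  note leg3 = third_leg_single_fee[where r = r, OF _ fH[unfolded H_def], folded defs]
  note firstD = reservation_first_legD[where D = D and r = r, folded defs]
  note thirdD = reservation_third_legD[where D = D and r = r, folded defs]
  \<comment> \<open>When no fees make the cost finite, any nonnegative fees are optimal; zero fees
    serve as witness.\<close>
  have trivial: ?thesis if "\<And>rule p q. routing_cost rule D r a p q = \<infinity>"
    using that by (intro exI[of _ "\<lambda>_. 0"] exI[of _ \<infinity>]) (auto simp: optimal_fees_def)
  \<comment> \<open>At most one endpoint is a hub, so the cases list which legs exist once every
    non-hub endpoint has a carrier.\<close>
  consider (none) "o' \<notin> H \<and> a o' = None \<or> d \<notin> H \<and> a d = None"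
    | (both) k l where "o' \<notin> H" "d \<notin> H" "k \<in> carriers D" "l \<in> carriers D" "a o' = Some k" "a d = Some l"
    | (first) k where "o' \<notin> H" "d \<in> H" "k \<in> carriers D" "a o' = Some k"
    | (third) l where "o' \<in> H" "d \<notin> H" "l \<in> carriers D" "a d = Some l"
    using od alloc by metis
  then show ?thesis
  proof cases
    case none
    then show ?thesis
      by (intro trivial) (use od in \<open>auto simp: routing_cost_def Let_def defs\<close>)
  next
    case both
    let ?g = "res_price D r k o'" and ?g' = "\<lambda>j. res_price D r l j d"
    let ?t = "\<lambda>(i, j). ?g i + c i j + ?g' j"
    \<comment> \<open>The two hubs are chosen jointly, since the interhub cost couples the
      legs.\<close>
    obtain z where z: "z \<in> H \<times> H" "\<And>y. y \<in> H \<times> H \<Longrightarrow> ?t z \<le> ?t y"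
      using ex_min_on_finite[of "H \<times> H" ?t] fH H by (simp add: Sigma_empty_iff) blast
    then obtain i j where ij: "i \<in> H" "j \<in> H" and "z = (i, j)"
      by auto
    then have min: "?g i + c i j + ?g' j \<le> ?g i' + c i' j' + ?g' j'"
      if "i' \<in> H" "j' \<in> H" for i' j'
      using z(2)[of "(i', j')"] that by simp
    \<comment> \<open>Each leg has a single acceptable hub, so only the route through
      \<open>i\<close> and \<open>j\<close> remains, and its fees equal the reservation
      prices.\<close>
    have "routing_cost rule D r a p q = ereal (?g i + c i j + ?g' j)"
      if "p r = single_fee ?g i" "q r = single_fee ?g' j" "rule \<in> carrier_rules" for p q rule
      using both ij that leg1[of rule i k p] leg3[of rule j l q] pos
      by (simp add: routing_cost_def Let_def single_fee_def c_def flip: defs)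
    moreover have "ereal (?g i + c i j + ?g' j) \<le> routing_cost reservation_oriented D r a p q" for p q
    proof -
      \<comment> \<open>Accepted fees are at least the reservation prices, so minimality of
        \<open>(i, j)\<close> bounds every available route.\<close>
      have "?g i + c i j + ?g' j \<le> p r i' + c i' j' + q r j'"
        if "i' \<in> first_leg_hubs reservation_oriented D (Some k) r p"
          "j' \<in> third_leg_hubs reservation_oriented D (Some l) r q" for i' j'
        using min[of i' j'] firstD[OF that(1)] thirdD[OF that(2)] by linarith
      then show ?thesis
        using both fin
        by (auto simp: routing_cost_def Let_def c_def simp flip: defs
            intro!: min_or_infinity_greatest finite_image_set2)
    qed
    moreover have "single_fee ?g i x \<ge> 0" "single_fee ?g' j x \<ge> 0" for x
      using pos both ij by (auto simp: single_fee_def less_imp_le)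
    ultimately show ?thesis unfolding optimal_fees_def by blast
  next
    case first
    let ?g = "res_price D r k o'"
    obtain i where i: "i \<in> H" and min: "\<And>i'. i' \<in> H \<Longrightarrow> ?g i + c i d \<le> ?g i' + c i' d"
      using ex_min_on_finite[OF fH H, of "\<lambda>i. ?g i + c i d"] by blast
    have "routing_cost rule D r a p q = ereal (?g i + c i d)"
      if "p r = single_fee ?g i" "rule \<in> carrier_rules" for p q rule
      using first i that leg1[of rule i k p] pos
      by (simp add: routing_cost_def Let_def single_fee_def c_def flip: defs)
    moreover have "ereal (?g i + c i d) \<le> routing_cost reservation_oriented D r a p q" for p q
    proof -
      have "?g i + c i d \<le> p r i' + c i' d"
        if "i' \<in> first_leg_hubs reservation_oriented D (Some k) r p" for i'
        using min[of i'] firstD[OF that] by linarith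
      then show ?thesis
        using first fin
        by (auto simp: routing_cost_def Let_def c_def simp flip: defs
            intro!: min_or_infinity_greatest finite_image_set)
    qed
    moreover have "single_fee ?g i x \<ge> 0" for x
      using pos first i by (auto simp: single_fee_def less_imp_le)
    \<comment> \<open>Any \<open>Q\<close> will do: the destination is a hub, so the sign condition
      on \<open>Q\<close> is void and the cost does not involve third-leg fees.\<close>
    ultimately show ?thesis
      unfolding optimal_fees_def using first(2) by (metis H_def d_def)
  next
    case third
    let ?g = "\<lambda>j. res_price D r l j d"
    obtain i where i: "i \<in> H" and min: "\<And>i'. i' \<in> H \<Longrightarrow> c o' i + ?g i \<le> c o' i' + ?g i'"
      using ex_min_on_finite[OF fH H, of "\<lambda>i. c o' i + ?g i"] by blast
    have "routing_cost rule D r a p q = ereal (c o' i + ?g i)"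
      if "q r = single_fee ?g i" "rule \<in> carrier_rules" for p q rule
      using third i that leg3[of rule i l q] pos
      by (simp add: routing_cost_def Let_def single_fee_def c_def flip: defs)
    moreover have "ereal (c o' i + ?g i) \<le> routing_cost reservation_oriented D r a p q" for p q
    proof -
      have "c o' i + ?g i \<le> c o' i' + q r i'"
        if "i' \<in> third_leg_hubs reservation_oriented D (Some l) r q" for i'
        using min[of i'] thirdD[OF that] by linarith
      then show ?thesis
        using third fin
        by (auto simp: routing_cost_def Let_def c_def simp flip: defs
            intro!: min_or_infinity_greatest finite_image_set)
    qed
    moreover have "single_fee ?g i x \<ge> 0" for x
      using pos third i by (auto simp: single_fee_def less_imp_le)
    ultimately show ?thesis
      unfolding optimal_fees_def using third(1) by (metis H_def o'_def)
  qed
qed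

section \<open>Optimal served set and fees for a fixed allocation\<close>

lemma optimal_response:
  fixes D :: "('v, 'k, 'r) fod_data"
  assumes D: "valid_data D" and a: "valid_allocation D a"
  shows "\<exists>S p q. feasible D (S, a, p, q) \<and>
     MCFOD_objective D (S, a, p, q) = rMCFOD_objective D (S, a, p, q) \<and>
     (\<forall>S' p' q'. feasible D (S', a, p', q') \<longrightarrow>
        rMCFOD_objective D (S', a, p', q') \<le> rMCFOD_objective D (S, a, p, q))"
proof -
  obtain p q m where fees: "\<And>r i. r \<in> commodities D \<Longrightarrow> i \<in> hubs D \<Longrightarrow>
        (orig D r \<notin> hubs D \<longrightarrow> p r i \<ge> 0) \<and> (dest D r \<notin> hubs D \<longrightarrow> q r i \<ge> 0)"
    and cost: "\<And>r rule. r \<in> commodities D \<Longrightarrow> rule \<in> carrier_rules \<Longrightarrow>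
        routing_cost rule D r a p q = m r"
    and lower: "\<And>r p' q'. r \<in> commodities D \<Longrightarrow>
        m r \<le> routing_cost reservation_oriented D r a p' q'"
  proof -
    \<comment> \<open>Fees are indexed by commodity, so the separate choices assemble into one pair
      \<open>p\<close>, \<open>q\<close>.\<close>
    obtain p q m where "optimal_fees D a r (p r) (q r) (m r)" if "r \<in> commodities D" for r
      using ex_optimal_fees[OF D a] by metis
    then show thesis
      by (intro that[of p q m]) (auto simp: optimal_fees_def)
  qed
  define t where "t r = ereal (revenue D r) - m r" for r
  \<comment> \<open>Exactly the commodities with nonnegative best margin are served. An infinite
    \<open>m r\<close> gives margin minus infinity and is thereby excluded.\<close>
  define S where "S = {r \<in> commodities D. 0 \<le> t r}"
  have fin: "finite (commodities D)"
    using D by (simp add: valid_data_def)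
  \<comment> \<open>Truncating margins at 0 turns the profit into a sum over all commodities, which
    can be compared with any other served set.\<close>
  have val: "total_profit rule D (S, a, p, q) = (\<Sum>r\<in>commodities D. max 0 (t r))"
    if "rule \<in> carrier_rules" for rule
  proof -
    have "total_profit rule D (S, a, p, q) = (\<Sum>r\<in>S. t r)"
      using cost[OF _ that] by (auto simp: total_profit_def S_def t_def intro!: sum.cong)
    also have "\<dots> = (\<Sum>r\<in>commodities D. max 0 (t r))"
      using fin by (intro sum.mono_neutral_cong_left) (auto simp: S_def max_def)
    finally show ?thesis .
  qed
  have "total_profit reservation_oriented D (S', a, p', q') \<le> (\<Sum>r\<in>commodities D. max 0 (t r))"
    if "S' \<subseteq> commodities D" for S' p' q'
  proof -
    have "total_profit reservation_oriented D (S', a, p', q') \<le> (\<Sum>r\<in>S'. max 0 (t r))"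
      unfolding total_profit_def prod.case
    proof (rule sum_mono)
      fix r assume "r \<in> S'"
      then have "ereal (revenue D r) - routing_cost reservation_oriented D r a p' q' \<le> t r"
        unfolding t_def using that lower by (intro ereal_minus_mono) auto
      then show "ereal (revenue D r) - routing_cost reservation_oriented D r a p' q' \<le> max 0 (t r)"
        by (simp add: le_max_iff_disj)
    qed
    \<comment> \<open>Enlarging \<open>S'\<close> to all commodities only adds nonnegative
      terms.\<close>
    also have "\<dots> \<le> (\<Sum>r\<in>commodities D. max 0 (t r))"
      using fin that by (intro sum_mono2) auto
    finally show ?thesis .
  qed
  moreover have "feasible D (S, a, p, q)"
    using a fees by (auto simp: feasible_def valid_allocation_def S_def)
  ultimately show ?thesis
    unfolding MCFOD_objective_def rMCFOD_objective_def
    using val by (intro exI[of _ S] exI[of _ p] exI[of _ q]) (auto simp: carrier_rules_def feasible_def)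
qed

section \<open>Maximization over allocations\<close>

lemma routing_cost_cong_allocation:
  assumes "orig D r \<notin> hubs D \<Longrightarrow> a (orig D r) = a' (orig D r)"
    "dest D r \<notin> hubs D \<Longrightarrow> a (dest D r) = a' (dest D r)"
    "\<not> (orig D r \<in> hubs D \<and> dest D r \<in> hubs D)"
  shows "routing_cost rule D r a p q = routing_cost rule D r a' p q"
  using assms by (auto simp: routing_cost_def Let_def)

lemma ex_joint_optimum:
  fixes D :: "('v, 'k, 'r) fod_data"
  assumes D: "valid_data D"
  obtains s where "feasible D s" "MCFOD_objective D s = rMCFOD_objective D s"
    "\<And>s'. feasible D s' \<Longrightarrow> rMCFOD_objective D s' \<le> rMCFOD_objective D s"
proof -
  define N where "N = nodes D - hubs D"
  \<comment> \<open>Allocations are total functions on the node type; fixing \<open>None\<close>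
    outside \<open>N\<close> leaves finitely many representatives.\<close>
  define Al where "Al = {a. \<forall>v. (v \<in> N \<longrightarrow> a v \<in> insert None (Some ` carriers D)) \<and>
    (v \<notin> N \<longrightarrow> a v = None)}"
  have "finite Al"
    unfolding Al_def using D by (intro finite_set_of_finite_funs) (auto simp: N_def valid_data_def)
  have valid: "valid_allocation D a" if "a \<in> Al" for a
    using that by (auto simp: Al_def N_def valid_allocation_def)
  have "\<forall>a\<in>Al. \<exists>s. feasible D s \<and> MCFOD_objective D s = rMCFOD_objective D s \<and>
     (\<forall>S' p' q'. feasible D (S', a, p', q') \<longrightarrow>
        rMCFOD_objective D (S', a, p', q') \<le> rMCFOD_objective D s)"
    using optimal_response[OF D valid] by blast
  from bchoice[OF this] obtain s where s: "\<And>a. a \<in> Al \<Longrightarrow> feasible D (s a) \<and>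
     MCFOD_objective D (s a) = rMCFOD_objective D (s a) \<and>
     (\<forall>S' p' q'. feasible D (S', a, p', q') \<longrightarrow>
        rMCFOD_objective D (S', a, p', q') \<le> rMCFOD_objective D (s a))"
    by blast
  have "Al \<noteq> {}"
    by (auto simp: Al_def intro: exI[of _ "\<lambda>_. None"])
  then obtain a where a: "a \<in> Al"
    and best: "\<And>a'. a' \<in> Al \<Longrightarrow> rMCFOD_objective D (s a') \<le> rMCFOD_objective D (s a)"
    using ex_max_on_finite[OF \<open>finite Al\<close>, of "\<lambda>a. rMCFOD_objective D (s a)"] by blast
  show thesis
  proof (rule that)
    fix s' assume s': "feasible D s'"
    obtain S b p q where [simp]: "s' = (S, b, p, q)" by (cases s')
    \<comment> \<open>Resetting an allocation outside \<open>N\<close> preserves the objective,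
      because costs consult it only at non-hub endpoints. Hence every feasible decision is covered
      by some member of \<open>Al\<close>.\<close>
    define b' where "b' v = (if v \<in> N then b v else None)" for v
    have "b' \<in> Al" "feasible D (S, b', p, q)"
      using s' by (auto simp: feasible_def Al_def b'_def N_def)
    moreover have "rMCFOD_objective D s' = rMCFOD_objective D (S, b', p, q)"
      using D s' unfolding rMCFOD_objective_def total_profit_def feasible_def valid_data_def
      by (auto simp: b'_def N_def intro!: sum.cong arg_cong2[where f = minus]
          routing_cost_cong_allocation)
    ultimately show "rMCFOD_objective D s' \<le> rMCFOD_objective D (s a)"
      using s best by fastforce
  qed (use s a in auto)
qed

text \<open>The cost comparison holds commodity by commodity and is reversed by subtraction from the
  revenue. This makes rMCFOD a relaxation of MCFOD over the same feasible set.\<close>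

lemma MCFOD_le_rMCFOD:
  assumes "valid_data D"
  shows "MCFOD_objective D s \<le> rMCFOD_objective D s"
proof -
  have "finite (hubs D)"
    using assms by (auto simp: valid_data_def intro: finite_subset)
  then show ?thesis
    by (cases s) (auto simp: MCFOD_objective_def rMCFOD_objective_def total_profit_def
        intro!: sum_mono ereal_minus_mono reservation_cost_le_profit_cost)
qed

theorem mainTheorem3:
  fixes D :: "('v, 'k, 'r) fod_data"
  assumes "valid_data D"
  shows "(SUP s \<in> {s. feasible D s}. MCFOD_objective D s) =
           (SUP s \<in> {s. feasible D s}. rMCFOD_objective D s) \<and>
         (\<exists>s. is_arg_max (MCFOD_objective D) (feasible D) s \<and>
              is_arg_max (rMCFOD_objective D) (feasible D) s)"
proof -
  obtain s where s: "feasible D s" "MCFOD_objective D s = rMCFOD_objective D s"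
    and r: "\<And>s'. feasible D s' \<Longrightarrow> rMCFOD_objective D s' \<le> rMCFOD_objective D s"
    using ex_joint_optimum[OF assms] by blast
  \<comment> \<open>An optimum of the relaxation at which both objectives agree is also optimal for
    MCFOD.\<close>
  have m: "MCFOD_objective D s' \<le> MCFOD_objective D s" if "feasible D s'" for s'
    using MCFOD_le_rMCFOD[OF assms, of s'] r[OF that] s(2) by simp
  have "(SUP s \<in> {s. feasible D s}. MCFOD_objective D s) = MCFOD_objective D s"
    using s(1) m by (intro antisym SUP_least SUP_upper) auto
  moreover have "(SUP s \<in> {s. feasible D s}. rMCFOD_objective D s) = rMCFOD_objective D s"
    using s(1) r by (intro antisym SUP_least SUP_upper) auto
  ultimately show ?thesis
    using s m r unfolding is_arg_max_linorder by (intro conjI exI[of _ s]) auto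
qed

end
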